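(* Let $E$ be any elliptic curve over $\mathbb{C}$, and regard its group of points $E(\mathbb{C})$ as a Lie group with its usual complex-analytic topology. Then there exists a continuous inverse ambiguous function $f : E(\mathbb{C}) \to E(\mathbb{C})$.
   Context: For a group $G$, a function $f : G \to G$ is called inverse ambiguous if it is bijective and its inverse function satisfies $f^{-1}(x) = (f(x))^{-1}$ for all $x \in G$, where the right-hand side is the group inverse of $f(x)$. Equivalently, $f(f(x)) = x^{-1}$ for all $x \in G$ (written additively on an elliptic curve: $f(f(P)) = -P$). It is a standard fact that every elliptic curve over $\mathbb{C}$ is isomorphic as a Lie group to a complex torus $\mathbb{C}/\Lambda$, where $\Lambda = \{n_1\omega_1 + n_2\omega_2 : n_1, n_2 \in \mathbb{Z}\}$ for some $\mathbb{R}$-linearly independent $\omega_1, \omega_2 \in \mathbb{C}$. *)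

theory Defs
  imports "HOL-Analysis.Analysis" "HOL-Algebra.Group"
begin

text \<open>
  The condition is the one on the inverse function of \<open>f\<close>, not its consequence
  \<open>f (f x) = inv x\<close>.  The group axioms are not part of the predicate: \<open>m_inv\<close> depends
  on the carrier, the multiplication and the unit only.
\<close>

definition inverse_ambiguous :: "('a, 'b) monoid_scheme \<Rightarrow> ('a \<Rightarrow> 'a) \<Rightarrow> bool" where
  "inverse_ambiguous G f \<longleftrightarrow>
     bij_betw f (carrier G) (carrier G) \<and>
     (\<forall>x\<in>carrier G. inv_into (carrier G) f x = inv\<^bsub>G\<^esub> (f x))"


section \<open>Complex projective space\<close>

definition proj_point :: "complex ^ 'n \<Rightarrow> (complex ^ 'n) set" where
  "proj_point v = {c *s v | c. c \<noteq> 0}"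

definition proj_space :: "(complex ^ 'n) set topology" where
  "proj_space = topology (\<lambda>U. U \<subseteq> proj_point ` (UNIV - {0}) \<and>
     openin (top_of_set (UNIV - {0})) {v \<in> UNIV - {0}. proj_point v \<in> U})"

lemma openin_proj_space:
  "openin proj_space U \<longleftrightarrow> U \<subseteq> proj_point ` (UNIV - {0}) \<and>
     openin (top_of_set (UNIV - {0})) {v \<in> UNIV - {0}. proj_point v \<in> U}"
proof -
  let ?pre = "\<lambda>U. {v \<in> UNIV - {0 :: complex ^ 'n}. proj_point v \<in> U}"
  have "istopology (\<lambda>U. U \<subseteq> proj_point ` (UNIV - {0 :: complex ^ 'n}) \<and>
          openin (top_of_set (UNIV - {0})) (?pre U))"
    unfolding istopology_def
  proof (intro conjI allI impI)
    fix S T :: "(complex ^ 'n) set set"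
    assume *: "S \<subseteq> proj_point ` (UNIV - {0}) \<and> openin (top_of_set (UNIV - {0})) (?pre S)"
      "T \<subseteq> proj_point ` (UNIV - {0}) \<and> openin (top_of_set (UNIV - {0})) (?pre T)"
    show "S \<inter> T \<subseteq> proj_point ` (UNIV - {0})" using * by blast
    have "?pre (S \<inter> T) = ?pre S \<inter> ?pre T" by blast
    then show "openin (top_of_set (UNIV - {0})) (?pre (S \<inter> T))"
      using * by (simp only:) (rule openin_Int, auto)
  next
    fix K :: "(complex ^ 'n) set set set"
    assume *: "\<forall>S\<in>K. S \<subseteq> proj_point ` (UNIV - {0}) \<and>
      openin (top_of_set (UNIV - {0})) (?pre S)"
    show "\<Union>K \<subseteq> proj_point ` (UNIV - {0})" using * by blast
    have "?pre (\<Union>K) = (\<Union>S\<in>K. ?pre S)" by blast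
    then show "openin (top_of_set (UNIV - {0})) (?pre (\<Union>K))"
      using * by (simp only:) (rule openin_Union, auto)
  qed
  then show ?thesis
    unfolding proj_space_def by (rule fun_cong[OF topology_inverse'])
qed

lemma topspace_proj_space: "topspace proj_space = proj_point ` (UNIV - {0 :: complex ^ 'n})"
proof (rule subset_antisym)
  show "topspace proj_space \<subseteq> proj_point ` (UNIV - {0})"
    using openin_proj_space openin_topspace by blast
  have "{v \<in> UNIV - {0 :: complex ^ 'n}. proj_point v \<in> proj_point ` (UNIV - {0})} = UNIV - {0}"
    by blast
  then have "openin proj_space (proj_point ` (UNIV - {0 :: complex ^ 'n}))"
    unfolding openin_proj_space by (intro conjI order_refl) (erule ssubst, rule openin_subtopology_self)
  then show "proj_point ` (UNIV - {0 :: complex ^ 'n}) \<subseteq> topspace proj_space"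
    by (rule openin_subset)
qed

lemma quotient_map_proj_point:
  "quotient_map (top_of_set (UNIV - {0 :: complex ^ 'n})) proj_space proj_point"
  by (simp add: quotient_map_def topspace_proj_space openin_proj_space)


section \<open>Elliptic curves over the complex numbers\<close>

record weierstrass =
  a\<^sub>1 :: complex
  a\<^sub>2 :: complex
  a\<^sub>3 :: complex
  a\<^sub>4 :: complex
  a\<^sub>6 :: complex

text \<open>
  The homogeneous form of the Weierstrass equation
  \<open>y\<^sup>2 + a\<^sub>1xy + a\<^sub>3y = x\<^sup>3 + a\<^sub>2x\<^sup>2 + a\<^sub>4x + a\<^sub>6\<close>.
\<close>

definition weierstrass_form :: "weierstrass \<Rightarrow> complex ^ 3 \<Rightarrow> complex" where
  "weierstrass_form W v =
     (let X = v $ 1; Y = v $ 2; Z = v $ 3 in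
       Y^2 * Z + a\<^sub>1 W * X * Y * Z + a\<^sub>3 W * Y * Z^2
       - (X^3 + a\<^sub>2 W * X^2 * Z + a\<^sub>4 W * X * Z^2 + a\<^sub>6 W * Z^3))"

text \<open>
  Smoothness of the projective plane cubic: at every nonzero zero of the form, some
  partial derivative does not vanish.  Every elliptic curve over \<open>\<complex>\<close> has such a model, with
  base point \<open>[0 : 1 : 0]\<close>.
\<close>

definition elliptic_curve :: "weierstrass \<Rightarrow> bool" where
  "elliptic_curve W \<longleftrightarrow>
     (\<forall>v. v \<noteq> 0 \<and> weierstrass_form W v = 0 \<longrightarrow>
       (\<exists>i. deriv (\<lambda>t. weierstrass_form W (v + t *s axis i 1)) 0 \<noteq> 0))"

text \<open>
  On the line \<open>Z = 0\<close> the form is \<open>- X\<^sup>3\<close>, so \<open>[0 : 1 : 0]\<close> is the only point of the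
  curve at infinity; all others are \<open>[x : y : 1]\<close> for unique \<open>x\<close> and \<open>y\<close>.
\<close>

datatype ec_point = At_Infinity | Affine_Point complex complex

fun hom_coords :: "ec_point \<Rightarrow> complex ^ 3" where
  "hom_coords At_Infinity = vector [0, 1, 0]"
| "hom_coords (Affine_Point x y) = vector [x, y, 1]"

definition ec_points :: "weierstrass \<Rightarrow> ec_point set" where
  "ec_points W = {P. weierstrass_form W (hom_coords P) = 0}"

text \<open>
  Chord-tangent addition with neutral element \<open>[0 : 1 : 0]\<close>.  The slope \<open>l\<close> is that of the chord
  through two distinct points, or of the tangent at a double point, and \<open>n\<close> is the
  intercept; the line \<open>y = l x + n\<close> meets the curve a third time at abscissa \<open>x\<^sub>3\<close>, and the sum
  is the reflection \<open>(x, y) \<mapsto> (x, - y - a\<^sub>1x - a\<^sub>3)\<close> of that third point.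
\<close>

fun ec_add :: "weierstrass \<Rightarrow> ec_point \<Rightarrow> ec_point \<Rightarrow> ec_point" where
  "ec_add W At_Infinity Q = Q"
| "ec_add W P At_Infinity = P"
| "ec_add W (Affine_Point x\<^sub>1 y\<^sub>1) (Affine_Point x\<^sub>2 y\<^sub>2) =
     (if x\<^sub>1 = x\<^sub>2 \<and> y\<^sub>1 + y\<^sub>2 + a\<^sub>1 W * x\<^sub>2 + a\<^sub>3 W = 0 then At_Infinity
      else
        let l = (if x\<^sub>1 \<noteq> x\<^sub>2 then (y\<^sub>2 - y\<^sub>1) / (x\<^sub>2 - x\<^sub>1)
                 else (3 * x\<^sub>1^2 + 2 * a\<^sub>2 W * x\<^sub>1 + a\<^sub>4 W - a\<^sub>1 W * y\<^sub>1)
                      / (2 * y\<^sub>1 + a\<^sub>1 W * x\<^sub>1 + a\<^sub>3 W));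
            n = y\<^sub>1 - l * x\<^sub>1;
            x\<^sub>3 = l^2 + a\<^sub>1 W * l - a\<^sub>2 W - x\<^sub>1 - x\<^sub>2
        in Affine_Point x\<^sub>3 (- (l * x\<^sub>3 + n) - a\<^sub>1 W * x\<^sub>3 - a\<^sub>3 W))"

definition ec_group :: "weierstrass \<Rightarrow> ec_point monoid" where
  "ec_group W = \<lparr>carrier = ec_points W, mult = ec_add W, one = At_Infinity\<rparr>"

text \<open>
  The complex-analytic topology, i.e. the one induced by the embedding into the
  complex projective plane.
\<close>

definition ec_topology :: "weierstrass \<Rightarrow> ec_point topology" where
  "ec_topology W = pullback_topology (ec_points W) (proj_point \<circ> hom_coords) proj_space"

lemma topspace_ec_topology: "topspace (ec_topology W) = carrier (ec_group W)"
proof -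
  have "hom_coords P \<noteq> 0" for P
    by (cases P) (auto simp: vec_eq_iff forall_3)
  then show ?thesis
    by (auto simp: ec_topology_def ec_group_def topspace_pullback_topology topspace_proj_space)
qed

end

theory Submission
  imports Defs "HOL-Computational_Algebra.Fundamental_Theorem_Algebra"
begin

text \<open>
  No uniformization is needed.  After completing the square the curve is \<open>z\<^sup>2 = h x\<close>, where \<open>h\<close>
  is a cubic with three distinct roots, and negation is \<open>(x, z) \<mapsto> (x, - z)\<close>: a double cover of
  the \<open>x\<close>-line with its deck transformation.  Multiplication by \<open>\<i>\<close> on a square torus induces on
  the line an involution that fixes one root and swaps the other two.  For arbitrary roots there is
  a piecewise real-linear involution \<open>g\<close> with this property such that \<open>(g y - g x) / (x - y)\<close>
  never lies on the branch cut of the square root.  Hence \<open>h (g x) / h x\<close> has the explicit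
  square root \<open>s x = \<i> \<Prod> csqrt ((g e - g x) / (x - e))\<close>, the product being over the roots \<open>e\<close>;
  it satisfies \<open>s (g x) * s x = - 1\<close>, and \<open>(x, z) \<mapsto> (g x, s x * z)\<close> squares to negation.
\<close>

section \<open>Factorization of monic cubics over the complex numbers\<close>

text \<open>The fundamental theorem of algebra supplies one root \<open>p\<close>. Dividing by
  \<open>x - p\<close> leaves \<open>x^2 + m * x + n\<close>, which the quadratic formula factors
  with \<open>w\<close> a square root of its discriminant.\<close>

lemma monic_cubic_splits:
  fixes b c d :: complex
  shows "\<exists>p q r. \<forall>x. x^3 + b * x^2 + c * x + d = (x - p) * (x - q) * (x - r)"
proof -
  have "\<not> constant (poly [:d, c, b, 1:])"
    by (simp add: constant_degree)
  then obtain p where p: "poly [:d, c, b, 1:] p = 0"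
    using fundamental_theorem_of_algebra by blast
  define m n where "m = b + p" and "n = c + b * p + p^2"
  define w where "w = csqrt (m^2 - 4 * n)"
  have w: "w^2 = m^2 - 4 * n" by (simp add: w_def)
  have d: "d = - p * n"
    using p unfolding n_def by (simp add: algebra_simps power2_eq_square eq_neg_iff_add_eq_0)
  have quad: "(x - (w - m) / 2) * (x - (- w - m) / 2) = x^2 + m * x + n" for x
  proof -
    have "(x - (w - m) / 2) * (x - (- w - m) / 2) = x^2 + m * x + (m^2 - w^2) / 4"
      by (simp add: field_simps power2_eq_square)
    then show ?thesis unfolding w by simp
  qed
  have "x^3 + b * x^2 + c * x + d = (x - p) * (x^2 + m * x + n)" for x
    unfolding d m_def n_def by (simp add: algebra_simps power2_eq_square power3_eq_cube)
  then have "x^3 + b * x^2 + c * x + d = (x - p) * (x - (w - m) / 2) * (x - (- w - m) / 2)" for x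
    unfolding quad[symmetric] mult.assoc .
  then show ?thesis by blast
qed

section \<open>Piecewise linear involutions of the plane\<close>

text \<open>Since \<open>Re (Complex 1 t * d) = Re d - t * Im d\<close>, each nonzero
  \<open>d\<close> rules out at most one real \<open>t\<close>. Applied to the pairwise differences
  of the roots, this gives a real-linear functional that takes distinct values on them.\<close>

lemma ex_complex_line_separating:
  fixes D :: "complex set"
  assumes "finite D" "0 \<notin> D"
  shows "\<exists>c. \<forall>d\<in>D. Re (c * d) \<noteq> 0"
proof -
  obtain t :: real where t: "t \<notin> (\<lambda>d. Re d / Im d) ` D"
    using ex_new_if_finite[OF infinite_UNIV_char_0] assms(1) by blast
  have "Re (Complex 1 t * d) \<noteq> 0" if "d \<in> D" for d
  proof
    assume *: "Re (Complex 1 t * d) = 0"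
    have "d \<noteq> 0" using that assms(2) by blast
    with * have "Im d \<noteq> 0" by (auto simp: complex_eq_iff)
    then have "t = Re d / Im d" using * by (simp add: field_simps)
    with t that show False by blast
  qed
  then show ?thesis by blast
qed

text \<open>
  The map \<open>g\<close> below is real-linear on each side of the line \<open>Re (c * (x - p)) = 0\<close>.  The last
  conclusion holds because \<open>g\<close> reverses the order given by \<open>Re (c * x)\<close> and is \<open>x \<mapsto> const - x\<close>
  on its level lines.
\<close>

lemma plane_involution_ordered:
  fixes c p q r :: complex
  assumes q: "Re (c * (q - p)) < 0" and r: "0 < Re (c * (r - p))"
  shows "\<exists>g. continuous_on UNIV g \<and> (\<forall>x. g (g x) = x) \<and> g ` {p, q, r} = {p, q, r} \<and>
    (\<forall>x y. x \<noteq> y \<longrightarrow> (g y - g x) / (x - y) \<notin> \<real>\<^sub>\<le>\<^sub>0)"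
proof -
  define l where "l = (\<lambda>x. Re (c * (x - p)))"
  \<comment> \<open>The maximum glues the slopes \<open>1 / l q\<close> on the negative side and
    \<open>1 / l r\<close> on the positive side into one continuous function with
    \<open>k (l q) = k (l r) = 1\<close>. Thus \<open>g\<close> is the point reflection in
    \<open>p\<close>, corrected by a multiple of \<open>q + r - 2 * p\<close> so that it swaps
    \<open>q\<close> and \<open>r\<close>.\<close>
  define k where "k = (\<lambda>t::real. max (t / l q) (t / l r))"
  define g where "g = (\<lambda>x. complex_of_real (k (l x)) * (q + r - 2 * p) + 2 * p - x)"
  have lq: "l q < 0" and lr: "l r > 0" using q r by (auto simp: l_def)
  have k_pos: "k t = t / l r" if "t \<ge> 0" for t
  proof -
    have "t / l q \<le> 0" "0 \<le> t / l r" using that lq lr by (auto simp: divide_le_0_iff)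
    then show ?thesis unfolding k_def by linarith
  qed
  have k_neg: "k t = t / l q" if "t \<le> 0" for t
  proof -
    have "t / l r \<le> 0" "0 \<le> t / l q" using that lq lr by (auto simp: divide_le_0_iff zero_le_divide_iff)
    then show ?thesis unfolding k_def by linarith
  qed
  have lg: "l (g x) = k (l x) * (l q + l r) - l x" for x
    unfolding g_def l_def by (simp add: algebra_simps)
  have lg_pos: "l (g x) = l x * (l q / l r)" if "l x \<ge> 0" for x
    using lr unfolding lg k_pos[OF that] by (simp add: field_simps)
  have lg_neg: "l (g x) = l x * (l r / l q)" if "l x \<le> 0" for x
    using lq unfolding lg k_neg[OF that] by (simp add: field_simps)
  have k_lg: "k (l (g x)) = k (l x)" for x
  proof (cases "l x \<ge> 0")
    case True
    have "l (g x) \<le> 0" unfolding lg_pos[OF True]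
      using True lq lr by (simp add: mult_le_0_iff divide_le_0_iff)
    then have "k (l (g x)) = l (g x) / l q" by (rule k_neg)
    then show ?thesis unfolding k_pos[OF True] lg_pos[OF True] using lq by simp
  next
    case False
    then have neg: "l x \<le> 0" by simp
    have "l (g x) \<ge> 0" unfolding lg_neg[OF neg]
      using neg lq lr by (intro mult_nonpos_nonpos) (auto simp: divide_le_0_iff)
    then have "k (l (g x)) = l (g x) / l r" by (rule k_pos)
    then show ?thesis unfolding k_neg[OF neg] lg_neg[OF neg] using lr by simp
  qed
  \<comment> \<open>As \<open>k (l x)\<close> is invariant under \<open>g\<close>, both applications
    of \<open>g\<close> subtract their argument from the same constant.\<close>
  have invol: "g (g x) = x" for x
  proof -
    have "g (g x) = complex_of_real (k (l (g x))) * (q + r - 2 * p) + 2 * p - g x"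
      by (simp add: g_def)
    then show ?thesis unfolding k_lg by (simp add: g_def)
  qed
  have cont_l: "continuous_on UNIV l"
    unfolding l_def by (intro continuous_intros)
  have cont: "continuous_on UNIV g"
    unfolding g_def k_def by (intro continuous_intros cont_l) (use lq lr in auto)
  have gp: "g p = p" by (simp add: g_def l_def k_def)
  have gq: "g q = r" using k_neg[of "l q"] lq by (simp add: g_def)
  have gr: "g r = q" using k_pos[of "l r"] lr by (simp add: g_def)
  have decr: "l (g x) < l (g y)" if "l y < l x" for x y
  proof -
    have neg: "l q / l r < 0" "l r / l q < 0"
      using lq lr by (simp_all add: divide_neg_pos divide_pos_neg)
    consider "l y \<ge> 0" | "l x \<le> 0" | "l y < 0" "l x > 0" by linarith
    then show ?thesis
    proof cases
      case 1
      then have "l x \<ge> 0" using that by linarith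
      show ?thesis
        unfolding lg_pos[OF 1] lg_pos[OF \<open>l x \<ge> 0\<close>] using that neg(1) by (rule mult_strict_right_mono_neg)
    next
      case 2
      then have "l y \<le> 0" using that by linarith
      show ?thesis
        unfolding lg_neg[OF 2] lg_neg[OF \<open>l y \<le> 0\<close>] using that neg(2) by (rule mult_strict_right_mono_neg)
    next
      case 3
      then have "l (g x) < 0"
        using mult_pos_neg[OF 3(2) neg(1)] lg_pos[of x] by linarith
      moreover have "0 < l (g y)"
        using mult_neg_neg[OF 3(1) neg(2)] lg_neg[of y] 3 by linarith
      ultimately show ?thesis by linarith
    qed
  qed
  have "(g y - g x) / (x - y) \<notin> \<real>\<^sub>\<le>\<^sub>0" if "x \<noteq> y" for x y
  proof
    assume "(g y - g x) / (x - y) \<in> \<real>\<^sub>\<le>\<^sub>0"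
    then obtain t where t: "t \<le> 0" "(g y - g x) / (x - y) = complex_of_real t"
      by (auto elim: nonpos_Reals_cases)
    then have eq: "g y - g x = of_real t * (x - y)" using that by (simp add: field_simps)
    have l_diff: "l u - l v = Re (c * (u - v))" for u v
      by (simp add: l_def algebra_simps)
    have "l (g y) - l (g x) = t * (l x - l y)"
      unfolding l_diff eq by (simp add: algebra_simps)
    moreover have "t * (l x - l y) \<le> 0" if "l y < l x"
      using t(1) that by (simp add: mult_le_0_iff)
    moreover have "t * (l x - l y) \<ge> 0" if "l x < l y"
      using t(1) that by (simp add: zero_le_mult_iff)
    \<comment> \<open>If the levels differed, \<open>t \<le> 0\<close> would give the left side a
      sign that contradicts the strict reversal of order by \<open>g\<close>.\<close>
    ultimately have "l x = l y" using decr[of x y] decr[of y x] by force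
    then have "g y - g x = x - y" by (simp add: g_def)
    then have "t = 1" using t(2) that by simp
    then show False using t(1) by simp
  qed
  moreover have "g ` {p, q, r} = {p, q, r}" by (simp add: gp gq gr insert_commute)
  ultimately show ?thesis using cont invol by blast
qed

text \<open>A functional that separates \<open>S\<close> orders its three elements. The middle one
  becomes the fixed point and the outer two are swapped, so the six possible orders reduce to one by
  relabelling.\<close>

lemma plane_involution:
  fixes S :: "complex set"
  assumes "card S = 3"
  shows "\<exists>g. continuous_on UNIV g \<and> (\<forall>x. g (g x) = x) \<and> g ` S = S \<and>
    (\<forall>x y. x \<noteq> y \<longrightarrow> (g y - g x) / (x - y) \<notin> \<real>\<^sub>\<le>\<^sub>0)"
proof -
  obtain p q r where S: "S = {p, q, r}" and ne: "p \<noteq> q" "q \<noteq> r" "p \<noteq> r"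
    using assms by (auto simp: card_3_iff)
  obtain c where "\<forall>d\<in>{p - q, q - r, p - r}. Re (c * d) \<noteq> 0"
    using ex_complex_line_separating[of "{p - q, q - r, p - r}"] ne by auto
  then have "Re (c * p) \<noteq> Re (c * q)" "Re (c * q) \<noteq> Re (c * r)" "Re (c * p) \<noteq> Re (c * r)"
    by (auto simp: algebra_simps)
  then consider
      "Re (c * q) < Re (c * p)" "Re (c * p) < Re (c * r)"
    | "Re (c * r) < Re (c * p)" "Re (c * p) < Re (c * q)"
    | "Re (c * p) < Re (c * q)" "Re (c * q) < Re (c * r)"
    | "Re (c * r) < Re (c * q)" "Re (c * q) < Re (c * p)"
    | "Re (c * p) < Re (c * r)" "Re (c * r) < Re (c * q)"
    | "Re (c * q) < Re (c * r)" "Re (c * r) < Re (c * p)"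
    by linarith
  then obtain p' q' r' where "S = {p', q', r'}" "Re (c * q') < Re (c * p')" "Re (c * p') < Re (c * r')"
    unfolding S by cases (blast+)
  then show ?thesis
    using plane_involution_ordered[of c q' p' r'] by (simp add: algebra_simps)
qed

section \<open>Lifting the involution to the double cover\<close>

text \<open>
  The square root of the product over \<open>S\<close> is single-valued because each quotient
  avoids the branch cut of \<open>csqrt\<close>; the factor \<open>\<i>\<close> accounts for the sign \<open>(-1)^3\<close>.
\<close>

lemma double_cover_lift:
  fixes S :: "complex set"
  assumes card: "card S = 3"
    and cont: "continuous_on UNIV g" and invol: "\<And>x. g (g x) = x" and gS: "g ` S = S"
    and slit: "\<And>x y. x \<noteq> y \<Longrightarrow> (g y - g x) / (x - y) \<notin> \<real>\<^sub>\<le>\<^sub>0"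
  defines "h \<equiv> \<lambda>x. \<Prod>e\<in>S. x - e"
  shows "\<exists>s. (\<forall>x z. z^2 = h x \<longrightarrow> (s x * z)^2 = h (g x) \<and> s (g x) * (s x * z) = - z) \<and>
    continuous_on {(x, z). z^2 = h x} (\<lambda>(x, z). s x * z)"
proof -
  define Q where "Q = (\<lambda>x e. (g e - g x) / (x - e))"
  define s where "s = (\<lambda>x. \<i> * (\<Prod>e\<in>S. csqrt (Q x e)))"
  have fin: "finite S" using card by (metis card.infinite zero_neq_numeral)
  have inj: "inj_on g S" by (metis inj_on_inverseI invol)
  have h0: "h x = 0 \<longleftrightarrow> x \<in> S" for x unfolding h_def using fin by auto
  have hg: "h (g x) = (\<Prod>e\<in>S. g x - g e)" for x
    unfolding h_def using prod.reindex[OF inj, of "\<lambda>e. g x - e"] gS by (simp add: o_def)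
  have h0g: "h (g x) = 0" if "h x = 0" for x
    using that gS unfolding h0 by blast
  have s_sq: "(s x)^2 * h x = h (g x)" if "h x \<noteq> 0" for x
  proof -
    have "(s x)^2 * h x = - (\<Prod>e\<in>S. Q x e * (x - e))"
      by (simp add: s_def h_def power_mult_distrib prod.distrib prod_power_distrib)
    also have "(\<Prod>e\<in>S. Q x e * (x - e)) = (\<Prod>e\<in>S. - 1 * (g x - g e))"
      using that unfolding h0 Q_def by (intro prod.cong) auto
    also have "\<dots> = - h (g x)"
      unfolding prod.distrib hg using card by simp
    finally show ?thesis by simp
  qed
  \<comment> \<open>At a root of \<open>h\<close> both sides are 0: there \<open>z = 0\<close>, and
    \<open>g\<close> maps roots to roots.\<close>
  have lift_sq: "(s x * z)^2 = h (g x)" if "z^2 = h x" for x z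
    using that s_sq[of x] h0g[of x] by (cases "h x = 0") (auto simp: power_mult_distrib)
  have s_s: "s (g x) * s x = - 1" if "h x \<noteq> 0" for x
  proof -
    \<comment> \<open>Because \<open>g\<close> is an involution, replacing \<open>x\<close> and
      \<open>e\<close> by their images inverts the quotient \<open>Q x e\<close>. Off the branch cut
      \<open>csqrt\<close> commutes with inversion, so the square roots cancel in pairs and only
      \<open>\<i>^2\<close> survives in \<open>s (g x) * s x\<close>.\<close>
    have one: "csqrt (Q (g x) (g e)) * csqrt (Q x e) = 1" if "e \<in> S" for e
    proof -
      have "x \<noteq> e" using \<open>h x \<noteq> 0\<close> that h0 by blast
      have Q: "Q (g x) (g e) = inverse (Q x e)"
        unfolding Q_def invol by (metis inverse_divide minus_diff_eq minus_divide_divide)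
      have nonpos: "Q x e \<notin> \<real>\<^sub>\<le>\<^sub>0" unfolding Q_def using slit \<open>x \<noteq> e\<close> by blast
      then have "csqrt (Q x e) \<noteq> 0" by auto
      then show ?thesis unfolding Q csqrt_inverse[OF nonpos] by simp
    qed
    have "(\<Prod>e\<in>S. csqrt (Q (g x) e)) = (\<Prod>e\<in>S. csqrt (Q (g x) (g e)))"
      using prod.reindex[OF inj, of "\<lambda>e. csqrt (Q (g x) e)"] gS by (simp add: o_def)
    then have "s (g x) * s x = - (\<Prod>e\<in>S. csqrt (Q (g x) (g e)) * csqrt (Q x e))"
      unfolding s_def prod.distrib by (simp add: mult_ac)
    then show ?thesis using one by simp
  qed
  have lift_lift: "s (g x) * (s x * z) = - z" if "z^2 = h x" for x z
    using that s_s[of x] by (cases "h x = 0") (auto simp flip: mult.assoc)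
  let ?C = "{(x, z). z^2 = h x}"
  have cont_h: "continuous_on UNIV h" unfolding h_def by (intro continuous_intros)
  have "((\<lambda>(x, z). s x * z) \<longlongrightarrow> s x0 * z0) (at (x0, z0) within ?C)"
    if C: "z0^2 = h x0" for x0 z0
  proof (cases "h x0 = 0")
    case True
    \<comment> \<open>\<open>s\<close> is discontinuous here, but \<open>s x * z\<close> has modulus \<open>sqrt \<bar>h (g x)\<bar>\<close>.\<close>
    have "continuous_on UNIV (\<lambda>u :: complex \<times> complex. sqrt (norm (h (g (fst u)))))"
      by (intro continuous_intros continuous_on_compose2[OF cont_h] continuous_on_compose2[OF cont]) auto
    then have "((\<lambda>u. sqrt (norm (h (g (fst u))))) \<longlongrightarrow> sqrt (norm (h (g (fst (x0, z0)))))) (at (x0, z0) within ?C)"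
      by (meson continuous_on_def UNIV_I tendsto_within_subset subset_UNIV)
    then have lim: "((\<lambda>u. sqrt (norm (h (g (fst u))))) \<longlongrightarrow> 0) (at (x0, z0) within ?C)"
      using h0g[OF True] by simp
    have "norm (s x * z) = sqrt (norm (h (g x)))" if "z^2 = h x" for x z
      using lift_sq[OF that] by (metis norm_power norm_ge_zero real_sqrt_unique)
    then have "eventually (\<lambda>u. norm (case u of (x, z) \<Rightarrow> s x * z) \<le> sqrt (norm (h (g (fst u))))) (at (x0, z0) within ?C)"
      by (intro eventually_at_topological[THEN iffD2] exI[of _ UNIV]) auto
    then have "((\<lambda>(x, z). s x * z) \<longlongrightarrow> 0) (at (x0, z0) within ?C)"
      using lim by (rule Lim_null_comparison)
    then show ?thesis using C True by simp
  next
    case False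
    have "isCont s x0"
      unfolding s_def Q_def
    proof (intro continuous_intros)
      fix e assume "e \<in> S"
      then have ne: "x0 \<noteq> e" using False h0 by blast
      have "isCont g x0" using cont by (simp add: continuous_on_eq_continuous_at)
      then have "isCont (\<lambda>x. (g e - g x) / (x - e)) x0"
        using ne by (intro continuous_intros) auto
      moreover have "(g e - g x0) / (x0 - e) \<notin> \<real>\<^sub>\<le>\<^sub>0" using slit ne by blast
      ultimately show "isCont (\<lambda>x. csqrt ((g e - g x) / (x - e))) x0"
        by (rule isCont_o2[OF _ continuous_at_csqrt])
    qed
    then have "isCont (\<lambda>u :: complex \<times> complex. s (fst u)) (x0, z0)"
      by (intro isCont_o2[where f = fst and g = s]) (simp_all add: isCont_fst)
    then have "isCont (\<lambda>u. s (fst u) * snd u) (x0, z0)"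
      by (intro isCont_mult isCont_snd continuous_ident)
    then have "((\<lambda>(x, z). s x * z) \<longlongrightarrow> s x0 * z0) (at (x0, z0))"
      by (simp add: isCont_def case_prod_unfold)
    then show ?thesis by (rule tendsto_within_subset) simp
  qed
  then have "continuous_on ?C (\<lambda>(x, z). s x * z)"
    by (auto simp: continuous_on_def)
  then show ?thesis using lift_sq lift_lift by (intro exI[of _ s]) auto
qed

section \<open>The topology of the curve in affine coordinates\<close>

lemma proj_point_eq_iff: "proj_point v = proj_point w \<longleftrightarrow> (\<exists>c. c \<noteq> 0 \<and> v = c *s w)"
proof
  assume *: "proj_point v = proj_point w"
  have "v \<in> proj_point v"
    unfolding proj_point_def by (intro CollectI exI[of _ 1]) simp
  then show "\<exists>c. c \<noteq> 0 \<and> v = c *s w"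
    unfolding * by (auto simp: proj_point_def)
next
  assume "\<exists>c. c \<noteq> 0 \<and> v = c *s w"
  then obtain c where c: "c \<noteq> 0" "v = c *s w" by blast
  have v: "a *s v = (a * c) *s w" for a
    unfolding c(2) by (rule vector_smult_assoc)
  have w: "a *s w = (a / c) *s v" for a
    using c(1) by (simp add: v)
  show "proj_point v = proj_point w"
  proof (intro subset_antisym subsetI)
    fix u assume "u \<in> proj_point v"
    then obtain a where "u = a *s v" "a \<noteq> 0" by (auto simp: proj_point_def)
    then show "u \<in> proj_point w"
      unfolding proj_point_def using c(1) by (intro CollectI exI[of _ "a * c"]) (simp add: v)
  next
    fix u assume "u \<in> proj_point w"
    then obtain a where "u = a *s w" "a \<noteq> 0" by (auto simp: proj_point_def)
    then show "u \<in> proj_point v"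
      unfolding proj_point_def using c(1) by (intro CollectI exI[of _ "a / c"]) (simp add: w)
  qed
qed

lemma hom_coords_nonzero: "hom_coords P \<noteq> 0"
  by (cases P) (auto simp: vec_eq_iff forall_3)

text \<open>The fibres of \<open>proj_point\<close> are orbits under nonzero scaling, so a set
  closed under such scaling is saturated.\<close>

lemma proj_point_in_image_iff:
  assumes "\<And>v c. v \<in> V \<Longrightarrow> c \<noteq> 0 \<Longrightarrow> c *s v \<in> V"
  shows "proj_point v \<in> proj_point ` V \<longleftrightarrow> v \<in> V"
  using assms by (auto simp: proj_point_eq_iff)

text \<open>Being saturated, the cone \<open>V\<close> is the full preimage of its image, and
  openness passes to the quotient.\<close>

lemma openin_proj_space_image:
  fixes V :: "(complex ^ 'n) set"
  assumes "open V" "0 \<notin> V" "\<And>v c. v \<in> V \<Longrightarrow> c \<noteq> 0 \<Longrightarrow> c *s v \<in> V"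
  shows "openin proj_space (proj_point ` V)"
proof -
  have "{v \<in> UNIV - {0}. proj_point v \<in> proj_point ` V} = V"
    using assms(2) proj_point_in_image_iff[of V, OF assms(3)] by auto
  moreover have "openin (top_of_set (UNIV - {0})) V"
    using assms(1,2) by (auto intro: open_subset)
  ultimately show ?thesis
    using assms(2) unfolding openin_proj_space by auto
qed

lemma continuous_on_vector_3 [continuous_intros]:
  assumes "continuous_on A f" "continuous_on A g" "continuous_on A h"
  shows "continuous_on A (\<lambda>u. vector [f u, g u, h u] :: 'b::{topological_space,zero} ^ 3)"
proof -
  have "(vector [a, b, c] :: 'b ^ 3) = (\<chi> i. if i = 1 then a else if i = 2 then b else c)" for a b c
    by (simp add: vec_eq_iff forall_3)
  moreover have "continuous_on A (\<lambda>u. if i = 1 then f u else if i = 2 then g u else h u)" for i :: 3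
    using assms by (cases "i = 1"; cases "i = 2") simp_all
  ultimately show ?thesis by (auto intro: continuous_on_vec_lambda)
qed

lemma affine_mem_ec_points:
  "Affine_Point x y \<in> ec_points W \<longleftrightarrow>
     y^2 + a\<^sub>1 W * x * y + a\<^sub>3 W * y = x^3 + a\<^sub>2 W * x^2 + a\<^sub>4 W * x + a\<^sub>6 W"
  by (simp add: ec_points_def weierstrass_form_def)

lemma infinity_mem_ec_points: "At_Infinity \<in> ec_points W"
  by (simp add: ec_points_def weierstrass_form_def)

text \<open>If \<open>norm y \<le> K * norm x\<close> and \<open>norm x \<ge> 1\<close>, every term
  of the equation other than \<open>x^3\<close> is bounded by a constant times
  \<open>norm x ^ 2\<close>. With \<open>M\<close> the sum of these constants,
  \<open>norm x ^ 3 \<le> M * norm x ^ 2\<close>, so \<open>norm x \<le> M\<close>.\<close>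

lemma ec_points_ordinate_dominates:
  assumes "K \<ge> 0"
  shows "\<exists>R\<ge>1. \<forall>x y. Affine_Point x y \<in> ec_points W \<longrightarrow> R < norm x \<longrightarrow> K * norm x < norm y"
proof -
  define M where "M = K^2 + norm (a\<^sub>1 W) * K + norm (a\<^sub>3 W) * K + norm (a\<^sub>2 W) + norm (a\<^sub>4 W) + norm (a\<^sub>6 W)"
  have "K * norm x < norm y" if P: "Affine_Point x y \<in> ec_points W" and R: "max 1 M < norm x" for x y
  proof (rule ccontr)
    assume "\<not> K * norm x < norm y"
    then have y: "norm y \<le> K * norm x" by simp
    define X where "X = norm x"
    have X: "1 \<le> X" using R unfolding X_def by simp
    have y2: "norm y ^ 2 \<le> K^2 * X^2"
      using power_mono[OF y norm_ge_zero, of 2] by (simp add: X_def power_mult_distrib)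
    have X1: "X \<le> X^2" using X by (simp add: power2_eq_square mult_left_le)
    have X0: "1 \<le> X^2" using X X1 by linarith
    have t1: "norm (a\<^sub>1 W) * X * norm y \<le> norm (a\<^sub>1 W) * K * X^2"
      using mult_left_mono[OF y, of "norm (a\<^sub>1 W) * X"] X by (simp add: X_def power2_eq_square algebra_simps)
    have t3: "norm (a\<^sub>3 W) * norm y \<le> norm (a\<^sub>3 W) * K * X^2"
    proof -
      have "norm y \<le> K * X^2" using y mult_left_mono[OF X1 assms] by (simp add: X_def)
      then show ?thesis using mult_left_mono[of "norm y" "K * X^2" "norm (a\<^sub>3 W)"] by (simp add: mult.assoc)
    qed
    have t4: "norm (a\<^sub>4 W) * X \<le> norm (a\<^sub>4 W) * X^2" using X1 by (simp add: mult_left_mono)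
    have t6: "norm (a\<^sub>6 W) \<le> norm (a\<^sub>6 W) * X^2" using mult_left_mono[OF X0, of "norm (a\<^sub>6 W)"] by simp
    have "x^3 = y^2 + a\<^sub>1 W * x * y + a\<^sub>3 W * y - a\<^sub>2 W * x^2 - a\<^sub>4 W * x - a\<^sub>6 W"
      using P by (simp add: affine_mem_ec_points)
    then have "X^3 = norm (y^2 + a\<^sub>1 W * x * y + a\<^sub>3 W * y - a\<^sub>2 W * x^2 - a\<^sub>4 W * x - a\<^sub>6 W)"
      by (simp add: X_def flip: norm_power)
    also have "\<dots> \<le> norm (y^2) + norm (a\<^sub>1 W * x * y) + norm (a\<^sub>3 W * y) + norm (a\<^sub>2 W * x^2)
        + norm (a\<^sub>4 W * x) + norm (a\<^sub>6 W)"
      by (intro order_trans[OF norm_triangle_ineq4] order_trans[OF norm_triangle_ineq] add_mono order_refl)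
    also have "\<dots> = norm y^2 + norm (a\<^sub>1 W) * X * norm y + norm (a\<^sub>3 W) * norm y + norm (a\<^sub>2 W) * X^2
        + norm (a\<^sub>4 W) * X + norm (a\<^sub>6 W)"
      by (simp add: norm_mult norm_power X_def)
    also have "\<dots> \<le> K^2 * X^2 + norm (a\<^sub>1 W) * K * X^2 + norm (a\<^sub>3 W) * K * X^2 + norm (a\<^sub>2 W) * X^2
        + norm (a\<^sub>4 W) * X^2 + norm (a\<^sub>6 W) * X^2"
      using y2 t1 t3 t4 t6 by linarith
    also have "\<dots> = M * X^2" by (simp add: M_def algebra_simps)
    finally have "X * X^2 \<le> M * X^2" by (simp add: power3_eq_cube power2_eq_square)
    then have "X \<le> M" by (rule mult_right_le_imp_le) (use X0 in linarith)
    then show False using R by (simp add: X_def)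
  qed
  then show ?thesis by (intro exI[of _ "max 1 M"]) auto
qed

text \<open>For bounded \<open>x\<close> the equation is a monic quadratic in \<open>y\<close> with
  bounded coefficients. When \<open>norm y \<ge> 1\<close>, the terms free of \<open>y\<close> may
  be multiplied by \<open>norm y\<close>, and cancelling that factor leaves
  \<open>norm y \<le> M\<close>.\<close>

lemma ec_points_bounded_ordinate:
  shows "\<exists>B. \<forall>x y. Affine_Point x y \<in> ec_points W \<longrightarrow> norm x \<le> R \<longrightarrow> norm y \<le> B"
proof -
  define M where "M = norm (a\<^sub>1 W) * R + norm (a\<^sub>3 W) + R^3 + norm (a\<^sub>2 W) * R^2 + norm (a\<^sub>4 W) * R + norm (a\<^sub>6 W)"
  have "norm y \<le> max 1 M" if P: "Affine_Point x y \<in> ec_points W" and x: "norm x \<le> R" for x y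
  proof (cases "norm y \<le> 1")
    case False
    then have y: "1 \<le> norm y" by simp
    have xn: "norm x ^ n \<le> R ^ n" for n by (rule power_mono[OF x norm_ge_zero])
    have "y^2 = x^3 + a\<^sub>2 W * x^2 + a\<^sub>4 W * x + a\<^sub>6 W - a\<^sub>1 W * x * y - a\<^sub>3 W * y"
      using P by (simp add: affine_mem_ec_points algebra_simps)
    then have "norm y^2 = norm (x^3 + a\<^sub>2 W * x^2 + a\<^sub>4 W * x + a\<^sub>6 W - a\<^sub>1 W * x * y - a\<^sub>3 W * y)"
      by (simp flip: norm_power)
    also have "\<dots> \<le> norm (x^3) + norm (a\<^sub>2 W * x^2) + norm (a\<^sub>4 W * x) + norm (a\<^sub>6 W)
        + norm (a\<^sub>1 W * x * y) + norm (a\<^sub>3 W * y)"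
      by (intro order_trans[OF norm_triangle_ineq4] order_trans[OF norm_triangle_ineq] add_mono order_refl)
    also have "\<dots> = (norm x^3 + norm (a\<^sub>2 W) * norm x^2 + norm (a\<^sub>4 W) * norm x + norm (a\<^sub>6 W))
        + (norm (a\<^sub>1 W) * norm x + norm (a\<^sub>3 W)) * norm y"
      by (simp add: norm_mult norm_power algebra_simps)
    also have "\<dots> \<le> (norm x^3 + norm (a\<^sub>2 W) * norm x^2 + norm (a\<^sub>4 W) * norm x + norm (a\<^sub>6 W)) * norm y
        + (norm (a\<^sub>1 W) * norm x + norm (a\<^sub>3 W)) * norm y"
    proof -
      have "0 \<le> norm x^3 + norm (a\<^sub>2 W) * norm x^2 + norm (a\<^sub>4 W) * norm x + norm (a\<^sub>6 W)" by simp
      from mult_left_mono[OF y this] show ?thesis by simp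
    qed
    also have "\<dots> = (norm (a\<^sub>1 W) * norm x + norm (a\<^sub>3 W) + norm x^3 + norm (a\<^sub>2 W) * norm x^2
        + norm (a\<^sub>4 W) * norm x + norm (a\<^sub>6 W)) * norm y"
      by (simp add: algebra_simps)
    also have "\<dots> \<le> M * norm y"
      unfolding M_def by (intro mult_right_mono add_mono mult_left_mono xn x order_refl norm_ge_zero)
    finally have "norm y * norm y \<le> M * norm y" by (simp add: power2_eq_square)
    then have "norm y \<le> M" by (rule mult_right_le_imp_le) (use y in linarith)
    then show ?thesis by simp
  qed simp
  then show ?thesis by blast
qed

text \<open>
  The neighbourhoods of \<open>[0 : 1 : 0]\<close> can be described by the abscissa alone because on the curve
  large \<open>y\<close> forces large \<open>x\<close>, and large \<open>x\<close> forces both \<open>x / y\<close> and \<open>1 / y\<close> to be small.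
\<close>

lemma openin_ec_topology:
  "openin (ec_topology W) T \<longleftrightarrow> T \<subseteq> ec_points W \<and>
     openin (top_of_set {(x, y). Affine_Point x y \<in> ec_points W}) {(x, y). Affine_Point x y \<in> T} \<and>
     (At_Infinity \<in> T \<longrightarrow>
       (\<exists>R. \<forall>x y. Affine_Point x y \<in> ec_points W \<longrightarrow> R < norm x \<longrightarrow> Affine_Point x y \<in> T))"
    (is "_ \<longleftrightarrow> _ \<and> openin (top_of_set ?C) ?T \<and> (_ \<longrightarrow> ?inf)")
proof (intro iffI conjI impI)
  assume "openin (ec_topology W) T"
  then obtain U where U: "openin proj_space U" and T: "T = (proj_point \<circ> hom_coords) -` U \<inter> ec_points W"
    unfolding ec_topology_def openin_pullback_topology by blast
  define V where "V = {v \<in> UNIV - {0}. proj_point v \<in> U}"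
  have "open (UNIV - {0 :: complex ^ 3})" by (simp add: open_delete)
  then have V: "open V"
    using U unfolding openin_proj_space V_def by (simp add: openin_open_eq)
  have T_iff: "P \<in> T \<longleftrightarrow> P \<in> ec_points W \<and> hom_coords P \<in> V" for P
    unfolding T V_def by (auto simp: hom_coords_nonzero)
  show "T \<subseteq> ec_points W" by (auto simp: T)
  have "open ((\<lambda>u. vector [fst u, snd u, 1]) -` V)"
    by (intro open_vimage V continuous_intros)
  moreover have "?T = ?C \<inter> (\<lambda>u. vector [fst u, snd u, 1]) -` V"
    by (auto simp: T_iff)
  ultimately show "openin (top_of_set ?C) ?T"
    by (simp add: openin_open_Int)
  assume "At_Infinity \<in> T"
  then have "vector [0, 1, 0] \<in> V" by (simp add: T_iff)
  \<comment> \<open>This is the chart \<open>Y = 1\<close>, with coordinates \<open>X / Y\<close>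
    and \<open>Z / Y\<close>, in which \<open>[0 : 1 : 0]\<close> is the origin.\<close>
  moreover have "open ((\<lambda>u. vector [fst u, 1, snd u]) -` V)"
    by (intro open_vimage V continuous_intros)
  ultimately obtain e where e: "e > 0" "ball (0, 0) e \<subseteq> (\<lambda>u. vector [fst u, 1, snd u]) -` V"
    by (metis (no_types, lifting) openE vimageI fst_conv snd_conv)
  \<comment> \<open>The factor \<open>2 / e\<close> makes \<open>norm (x / y) < e / 2\<close>; as
    \<open>norm x > 1\<close>, also \<open>norm (1 / y) < e / 2\<close>. Hence the pair lies in the
    ball of radius \<open>e\<close>.\<close>
  obtain R where R: "R \<ge> 1" "\<And>x y. Affine_Point x y \<in> ec_points W \<Longrightarrow> R < norm x \<Longrightarrow> 2 / e * norm x < norm y"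
    using ec_points_ordinate_dominates[of "2 / e" W] e by auto
  have "Affine_Point x y \<in> T" if P: "Affine_Point x y \<in> ec_points W" and x: "R < norm x" for x y
  proof -
    have y: "2 * norm x < e * norm y" using R(2)[OF P x] e(1) by (simp add: field_simps)
    have x1: "1 < norm x" using R(1) x by simp
    have "0 < e * norm y" using y x1 by linarith
    then have y0: "y \<noteq> 0" by auto
    have "norm (x / y) < e / 2" "norm (1 / y) < e / 2"
      using y x1 y0 by (auto simp: norm_divide field_simps)
    then have "norm (x / y, 1 / y) < e"
      using norm_Pair_le[of "x / y" "1 / y"] by linarith
    then have "(x / y, 1 / y) \<in> ball (0, 0) e"
      by (simp add: dist_Pair_Pair dist_norm norm_Pair)
    then have v: "vector [x / y, 1, 1 / y] \<in> V" using e(2) by auto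
    have "vector [x, y, 1] = y *s (vector [x / y, 1, 1 / y] :: complex ^ 3)"
      using y0 by (simp add: vec_eq_iff forall_3)
    then have "proj_point (vector [x, y, 1]) = proj_point (vector [x / y, 1, 1 / y] :: complex ^ 3)"
      using y0 proj_point_eq_iff by blast
    then have "hom_coords (Affine_Point x y) \<in> V"
      using v hom_coords_nonzero[of "Affine_Point x y"] unfolding V_def by simp
    then show ?thesis using P by (simp add: T_iff)
  qed
  then show ?inf by blast
next
  assume *: "T \<subseteq> ec_points W \<and> openin (top_of_set ?C) ?T \<and> (At_Infinity \<in> T \<longrightarrow> ?inf)"
  then obtain A where A: "open A" "?T = ?C \<inter> A" by (auto simp: openin_open)
  have A_iff: "Affine_Point x y \<in> T \<longleftrightarrow> (x, y) \<in> A" if "Affine_Point x y \<in> ec_points W" for x y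
    using that A(2) by (auto simp: set_eq_iff)
  \<comment> \<open>\<open>B\<close> bounds the ordinates over \<open>norm x \<le> R\<close>, so a
    larger ordinate forces \<open>norm x > R\<close>. The premise on \<open>At_Infinity\<close> lets
    one statement serve both cases.\<close>
  obtain B where B: "\<And>x y. At_Infinity \<in> T \<Longrightarrow> Affine_Point x y \<in> ec_points W \<Longrightarrow> B < norm y \<Longrightarrow> Affine_Point x y \<in> T"
  proof (cases "At_Infinity \<in> T")
    case True
    then obtain R where R: "\<And>x y. Affine_Point x y \<in> ec_points W \<Longrightarrow> R < norm x \<Longrightarrow> Affine_Point x y \<in> T"
      using * by blast
    then show ?thesis using that ec_points_bounded_ordinate[of W R] by (metis linorder_not_le)
  qed (use that in blast)
  \<comment> \<open>\<open>V1\<close> is the cone over \<open>A\<close> in the chart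
    \<open>Z = 1\<close>. \<open>V2\<close> is the cone over a neighbourhood of
    \<open>[0 : 1 : 0]\<close>, or empty if \<open>At_Infinity\<close> is not in \<open>T\<close>.
    Together they cut out exactly \<open>T\<close> on the curve.\<close>
  define V1 where "V1 = {v :: complex ^ 3. v $ 3 \<noteq> 0 \<and> (v $ 1 / v $ 3, v $ 2 / v $ 3) \<in> A}"
  define V2 where "V2 = {v :: complex ^ 3. At_Infinity \<in> T \<and> B * norm (v $ 3) < norm (v $ 2)}"
  have "open {v :: complex ^ 3. v $ 3 \<noteq> 0}"
    by (intro open_Collect_neq continuous_intros)
  then have "open ({v :: complex ^ 3. v $ 3 \<noteq> 0} \<inter> (\<lambda>v. (v $ 1 / v $ 3, v $ 2 / v $ 3)) -` A)"
    by (intro continuous_open_preimage A(1)) (auto intro!: continuous_intros)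
  moreover have "{v. v $ 3 \<noteq> 0} \<inter> (\<lambda>v. (v $ 1 / v $ 3, v $ 2 / v $ 3)) -` A = V1"
    by (auto simp: V1_def)
  moreover have "open V2"
    unfolding V2_def by (intro open_Collect_conj open_Collect_const open_Collect_less continuous_intros)
  ultimately have "open (V1 \<union> V2)" by auto
  moreover have "0 \<notin> V1 \<union> V2" by (simp add: V1_def V2_def)
  moreover have cone: "c *s v \<in> V1 \<union> V2" if "v \<in> V1 \<union> V2" "c \<noteq> 0" for v c
    using that by (auto simp: V1_def V2_def norm_mult mult.left_commute)
  ultimately have U: "openin proj_space (proj_point ` (V1 \<union> V2))"
    by (rule openin_proj_space_image)
  have T_iff: "P \<in> T \<longleftrightarrow> P \<in> ec_points W \<and> hom_coords P \<in> V1 \<union> V2" for P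
  proof (cases P)
    case At_Infinity
    then show ?thesis by (simp add: V1_def V2_def infinity_mem_ec_points)
  next
    case (Affine_Point x y)
    then show ?thesis using * A_iff[of x y] B[of x y] by (auto simp: V1_def V2_def)
  qed
  have "T = (proj_point \<circ> hom_coords) -` (proj_point ` (V1 \<union> V2)) \<inter> ec_points W"
  proof (rule Set.set_eqI)
    show "P \<in> T \<longleftrightarrow> P \<in> (proj_point \<circ> hom_coords) -` (proj_point ` (V1 \<union> V2)) \<inter> ec_points W" for P
      using proj_point_in_image_iff[of "V1 \<union> V2" "hom_coords P", OF cone] T_iff[of P]
      unfolding Int_iff vimage_eq o_apply by blast
  qed
  then show "openin (ec_topology W) T"
    using U unfolding ec_topology_def openin_pullback_topology by blast
qed

text \<open>By the description of the open sets, continuity at affine points is that of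
  \<open>F\<close>. Continuity at the fixed point \<open>At_Infinity\<close> follows if the new
  abscissa is large whenever the old one is.\<close>

lemma continuous_map_ec_topology:
  assumes cont: "continuous_on {(x, y). Affine_Point x y \<in> ec_points W} F"
    and maps: "\<And>x y. Affine_Point x y \<in> ec_points W \<Longrightarrow> case_prod Affine_Point (F (x, y)) \<in> ec_points W"
    and infinity: "\<And>R. \<exists>R'. \<forall>x y. Affine_Point x y \<in> ec_points W \<longrightarrow> R' < norm x \<longrightarrow> R < norm (fst (F (x, y)))"
  defines "f \<equiv> \<lambda>P. case P of At_Infinity \<Rightarrow> At_Infinity | Affine_Point x y \<Rightarrow> case_prod Affine_Point (F (x, y))"
  shows "continuous_map (ec_topology W) (ec_topology W) f"
proof -
  let ?C = "{(x, y). Affine_Point x y \<in> ec_points W}"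
  have top: "topspace (ec_topology W) = ec_points W"
    by (simp add: topspace_ec_topology ec_group_def)
  have f_in: "f P \<in> ec_points W" if "P \<in> ec_points W" for P
    using that maps by (cases P) (auto simp: f_def infinity_mem_ec_points)
  have "openin (ec_topology W) {P \<in> ec_points W. f P \<in> T}" if T: "openin (ec_topology W) T" for T
    unfolding openin_ec_topology
  proof (intro conjI impI)
    have "F \<in> ?C \<rightarrow> ?C" using maps by fastforce
    then have "openin (top_of_set ?C) (?C \<inter> F -` {(x, y). Affine_Point x y \<in> T})"
      using cont T continuous_openin_preimage unfolding openin_ec_topology by blast
    moreover have "?C \<inter> F -` {(x, y). Affine_Point x y \<in> T} =
        {(x, y). Affine_Point x y \<in> {P \<in> ec_points W. f P \<in> T}}"
      by (auto simp: f_def case_prod_unfold)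
    ultimately show "openin (top_of_set ?C) {(x, y). Affine_Point x y \<in> {P \<in> ec_points W. f P \<in> T}}"
      by simp
    assume "At_Infinity \<in> {P \<in> ec_points W. f P \<in> T}"
    then have "At_Infinity \<in> T" by (simp add: f_def)
    then obtain R where R: "\<And>x y. Affine_Point x y \<in> ec_points W \<Longrightarrow> R < norm x \<Longrightarrow> Affine_Point x y \<in> T"
      using T unfolding openin_ec_topology by blast
    obtain R' where R': "\<And>x y. Affine_Point x y \<in> ec_points W \<Longrightarrow> R' < norm x \<Longrightarrow> R < norm (fst (F (x, y)))"
      using infinity by blast
    have "f (Affine_Point x y) \<in> T" if "Affine_Point x y \<in> ec_points W" "R' < norm x" for x y
      using R'[OF that] maps[OF that(1)] R by (cases "F (x, y)") (auto simp: f_def)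
    then show "\<exists>R. \<forall>x y. Affine_Point x y \<in> ec_points W \<longrightarrow> R < norm x \<longrightarrow>
        Affine_Point x y \<in> {P \<in> ec_points W. f P \<in> T}"
      by (intro exI[of _ R']) auto
  qed auto
  then show ?thesis using f_in by (auto simp: continuous_map_def top)
qed

section \<open>Negation and inverse ambiguity in the group of points\<close>

text \<open>In the coordinate \<open>z = y + (a\<^sub>1 W * x + a\<^sub>3 W) / 2\<close> this is
  \<open>z \<mapsto> - z\<close>.\<close>

definition ec_neg :: "weierstrass \<Rightarrow> ec_point \<Rightarrow> ec_point" where
  "ec_neg W P = (case P of At_Infinity \<Rightarrow> At_Infinity
     | Affine_Point x y \<Rightarrow> Affine_Point x (- y - a\<^sub>1 W * x - a\<^sub>3 W))"

lemma ec_neg_in_ec_points: "P \<in> ec_points W \<Longrightarrow> ec_neg W P \<in> ec_points W"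
  by (cases P) (auto simp: ec_neg_def affine_mem_ec_points algebra_simps power2_eq_square)

text \<open>For two affine points only the first branch of \<open>ec_add\<close> yields
  \<open>At_Infinity\<close>, and its condition is the reflection formula. The addition law itself
  thus gives both existence and uniqueness of the inverse.\<close>

lemma ec_add_eq_infinity_iff: "ec_add W P Q = At_Infinity \<longleftrightarrow> Q = ec_neg W P"
proof (cases P; cases Q)
  fix x y x' y' assume "P = Affine_Point x y" "Q = Affine_Point x' y'"
  then show ?thesis
    by (auto simp: ec_neg_def Let_def algebra_simps eq_neg_iff_add_eq_0)
qed (auto simp: ec_neg_def)

lemma ec_neg_neg: "ec_neg W (ec_neg W P) = P"
  by (cases P) (auto simp: ec_neg_def)

lemma inv_ec_group:
  assumes "P \<in> ec_points W"
  shows "inv\<^bsub>ec_group W\<^esub> P = ec_neg W P"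
  unfolding m_inv_def
proof (rule the_equality)
  show "ec_neg W P \<in> carrier (ec_group W) \<and>
      P \<otimes>\<^bsub>ec_group W\<^esub> ec_neg W P = \<one>\<^bsub>ec_group W\<^esub> \<and> ec_neg W P \<otimes>\<^bsub>ec_group W\<^esub> P = \<one>\<^bsub>ec_group W\<^esub>"
    using assms by (simp add: ec_group_def ec_neg_in_ec_points ec_add_eq_infinity_iff ec_neg_neg)
  fix Q
  assume "Q \<in> carrier (ec_group W) \<and>
      P \<otimes>\<^bsub>ec_group W\<^esub> Q = \<one>\<^bsub>ec_group W\<^esub> \<and> Q \<otimes>\<^bsub>ec_group W\<^esub> P = \<one>\<^bsub>ec_group W\<^esub>"
  then have "ec_add W P Q = At_Infinity" by (simp add: ec_group_def)
  then show "Q = ec_neg W P" unfolding ec_add_eq_infinity_iff .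
qed

text \<open>The candidate inverse of \<open>f\<close> is \<open>f\<close> followed by negation;
  applying \<open>f\<close> first and then the candidate gives \<open>- (- P) = P\<close>.\<close>

lemma inverse_ambiguous_ec_groupI:
  assumes maps: "\<And>P. P \<in> ec_points W \<Longrightarrow> f P \<in> ec_points W"
    and ff: "\<And>P. P \<in> ec_points W \<Longrightarrow> f (f P) = ec_neg W P"
  shows "inverse_ambiguous (ec_group W) f"
proof -
  have left: "ec_neg W (f (f P)) = P" if "P \<in> ec_points W" for P
    using ff[OF that] by (simp add: ec_neg_neg)
  \<comment> \<open>Negation is \<open>f\<close> applied twice, so it commutes with
    \<open>f\<close>: both \<open>f (ec_neg W (f P))\<close> and \<open>ec_neg W (f (f P))\<close>
    are the fourth iterate of \<open>f\<close> at \<open>P\<close>.\<close>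
  have right: "f (ec_neg W (f P)) = P" if "P \<in> ec_points W" for P
    using ff[OF maps[OF that]] ff[OF maps[OF maps[OF that]]] left[OF that] by simp
  have inj: "inj_on f (ec_points W)"
    by (rule inj_on_inverseI[where g = "\<lambda>Q. ec_neg W (f Q)"]) (rule left)
  have bij: "bij_betw f (ec_points W) (ec_points W)"
    by (rule bij_betw_byWitness[where f' = "\<lambda>Q. ec_neg W (f Q)"])
       (auto simp: left right maps ec_neg_in_ec_points)
  have "inv_into (ec_points W) f P = ec_neg W (f P)" if "P \<in> ec_points W" for P
    using that by (intro inv_into_f_eq inj ec_neg_in_ec_points maps right)
  then show ?thesis
    using bij maps unfolding inverse_ambiguous_def
    by (simp add: inv_ec_group ec_group_def[THEN arg_cong[where f = carrier]])
qed

section \<open>Smoothness and the roots of the cubic\<close>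

text \<open>The cubic \<open>x\<^sup>3 + (b\<^sub>2/4) x\<^sup>2 + (b\<^sub>4/2) x + b\<^sub>6/4\<close> in the usual notation.\<close>

definition ec_cubic :: "weierstrass \<Rightarrow> complex \<Rightarrow> complex" where
  "ec_cubic W x = x^3 + (a\<^sub>2 W + (a\<^sub>1 W)^2 / 4) * x^2 + (a\<^sub>4 W + a\<^sub>1 W * a\<^sub>3 W / 2) * x
     + (a\<^sub>6 W + (a\<^sub>3 W)^2 / 4)"

lemma ec_points_complete_square:
  "Affine_Point x y \<in> ec_points W \<longleftrightarrow> (y + (a\<^sub>1 W * x + a\<^sub>3 W) / 2)^2 = ec_cubic W x"
proof -
  have "(y + (a\<^sub>1 W * x + a\<^sub>3 W) / 2)^2 - ec_cubic W x =
      (y^2 + a\<^sub>1 W * x * y + a\<^sub>3 W * y) - (x^3 + a\<^sub>2 W * x^2 + a\<^sub>4 W * x + a\<^sub>6 W)"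
    unfolding ec_cubic_def by (simp add: field_simps power2_eq_square)
  then show ?thesis unfolding affine_mem_ec_points by (metis eq_iff_diff_eq_0)
qed

text \<open>Over a double root \<open>e\<close>, the curve point fixed by negation is singular: the
  coefficients expressed through \<open>e\<close> and \<open>k\<close> make all three partial
  derivatives of the form vanish there.\<close>

lemma ec_cubic_no_double_root:
  assumes E: "elliptic_curve W"
  shows "\<exists>x. ec_cubic W x \<noteq> (x - e) * (x - e) * (x - k)"
proof (rule ccontr)
  assume "\<not> ?thesis"
  then have fact: "ec_cubic W x = (x - e) * (x - e) * (x - k)" for x by blast
  have a6: "a\<^sub>6 W = - ((a\<^sub>3 W)^2) / 4 - e^2 * k"
  proof -
    have "a\<^sub>6 W + (a\<^sub>3 W)^2 / 4 = - (e^2 * k)"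
      using fact[of 0] by (simp add: ec_cubic_def power2_eq_square)
    then have "a\<^sub>6 W = - (e^2 * k) - (a\<^sub>3 W)^2 / 4" by (simp only: eq_diff_eq)
    then show ?thesis by simp
  qed
  define b c where "b = a\<^sub>2 W + (a\<^sub>1 W)^2 / 4" and "c = a\<^sub>4 W + a\<^sub>1 W * a\<^sub>3 W / 2"
  have bc: "x^3 + b * x^2 + c * x - e^2 * k = (x - e) * (x - e) * (x - k)" for x
    using fact[of x] by (simp add: ec_cubic_def a6 b_def c_def)
  \<comment> \<open>Comparison of coefficients by evaluation: the sum of the identities at 1 and -1
    determines \<open>b\<close>, their difference \<open>c\<close>.\<close>
  have p: "1 + b + c - e^2 * k = (1 - e) * (1 - e) * (1 - k)"
    using bc[of 1] by simp
  have m: "- 1 + b - c - e^2 * k = (- 1 - e) * (- 1 - e) * (- 1 - k)"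
    using bc[of "-1"] by simp
  have "2 * b = 2 * (- 2 * e - k)"
    using p m by algebra
  then have "b = - 2 * e - k" unfolding mult_cancel_left by simp
  moreover have "a\<^sub>2 W = b - (a\<^sub>1 W)^2 / 4" by (simp add: b_def)
  ultimately have a2: "a\<^sub>2 W = - ((a\<^sub>1 W)^2) / 4 - 2 * e - k" by simp
  have "2 * c = 2 * (e^2 + 2 * e * k)"
    using p m by algebra
  then have "c = e^2 + 2 * e * k" unfolding mult_cancel_left by simp
  moreover have "a\<^sub>4 W = c - a\<^sub>1 W * a\<^sub>3 W / 2" by (simp add: c_def)
  ultimately have a4: "a\<^sub>4 W = - a\<^sub>1 W * a\<^sub>3 W / 2 + e^2 + 2 * e * k" by simp
  \<comment> \<open>The ordinate at which the completed square vanishes.\<close>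
  define y where "y = - (a\<^sub>1 W * e + a\<^sub>3 W) / 2"
  let ?v = "vector [e, y, 1] :: complex ^ 3"
  have curve: "(y + (a\<^sub>1 W * e + a\<^sub>3 W) / 2)^2 = ec_cubic W e"
    by (simp add: fact y_def flip: add_divide_distrib)
  then have "Affine_Point e y \<in> ec_points W" by (simp only: ec_points_complete_square)
  then have "weierstrass_form W ?v = 0" by (simp add: ec_points_def)
  moreover have "?v \<noteq> 0" by (simp add: vec_eq_iff forall_3)
  ultimately obtain i where i: "deriv (\<lambda>t. weierstrass_form W (?v + t *s axis i 1)) 0 \<noteq> 0"
    using E unfolding elliptic_curve_def by blast
  have "((\<lambda>t. weierstrass_form W (?v + t *s axis i 1)) has_field_derivative 0) (at 0)"
    if "i = 1 \<or> i = 2 \<or> i = 3"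
    using that
  proof (elim disjE)
    assume "i = 1"
    then show ?thesis unfolding weierstrass_form_def Let_def
      by (auto intro!: derivative_eq_intros simp: axis_def a2 a4 a6 y_def field_simps power2_eq_square)
  next
    assume "i = 2"
    then show ?thesis unfolding weierstrass_form_def Let_def
      by (auto intro!: derivative_eq_intros simp: axis_def a2 a4 a6 y_def field_simps power2_eq_square)
  next
    assume "i = 3"
    then show ?thesis unfolding weierstrass_form_def Let_def
      by (auto intro!: derivative_eq_intros simp: axis_def a2 a4 a6 y_def field_simps power2_eq_square)
  qed
  then show False using i DERIV_imp_deriv exhaust_3 by blast
qed

lemma ec_cubic_splits:
  assumes "elliptic_curve W"
  shows "\<exists>S. card S = 3 \<and> (\<forall>x. ec_cubic W x = (\<Prod>e\<in>S. x - e))"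
proof -
  obtain p q r where fact: "\<And>x. ec_cubic W x = (x - p) * (x - q) * (x - r)"
    unfolding ec_cubic_def using monic_cubic_splits by blast
  have "p \<noteq> q" using ec_cubic_no_double_root[OF assms, of p r] fact by auto
  moreover have "p \<noteq> r" using ec_cubic_no_double_root[OF assms, of p q] fact by (auto simp: mult_ac)
  moreover have "q \<noteq> r" using ec_cubic_no_double_root[OF assms, of q p] fact by (auto simp: mult_ac)
  ultimately show ?thesis using fact by (intro exI[of _ "{p, q, r}"]) (simp add: mult_ac)
qed

section \<open>Assembling the map on the curve from the involution and its lift\<close>

theorem theorem3p1:
  fixes E :: weierstrass
  assumes "elliptic_curve E"
  shows "\<exists>f. continuous_map (ec_topology E) (ec_topology E) f \<and> inverse_ambiguous (ec_group E) f"
proof -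
  obtain S where S: "card S = 3" and cubic: "\<And>x. ec_cubic E x = (\<Prod>e\<in>S. x - e)"
    using ec_cubic_splits[OF assms] by blast
  obtain g where g: "continuous_on UNIV g" "\<And>x. g (g x) = x" "g ` S = S"
    "\<And>x y. x \<noteq> y \<Longrightarrow> (g y - g x) / (x - y) \<notin> \<real>\<^sub>\<le>\<^sub>0"
    using plane_involution[OF S] by blast
  obtain s where s: "\<And>x z. z^2 = ec_cubic E x \<Longrightarrow> (s x * z)^2 = ec_cubic E (g x) \<and> s (g x) * (s x * z) = - z"
    and cont_s: "continuous_on {(x, z). z^2 = ec_cubic E x} (\<lambda>(x, z). s x * z)"
    using double_cover_lift[OF S g] unfolding cubic by blast
  define m where "m = (\<lambda>x. (a\<^sub>1 E * x + a\<^sub>3 E) / 2)"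
  \<comment> \<open>With \<open>z = y + m x\<close> this is
    \<open>(x, z) \<mapsto> (g x, s x * z)\<close>, translated back to the ordinate by subtracting
    \<open>m (g x)\<close>.\<close>
  define F where "F = (\<lambda>(x, y). (g x, s x * (y + m x) - m (g x)))"
  define f where "f = (\<lambda>P. case P of At_Infinity \<Rightarrow> At_Infinity | Affine_Point x y \<Rightarrow> case_prod Affine_Point (F (x, y)))"
  have mem: "Affine_Point x y \<in> ec_points E \<longleftrightarrow> (y + m x)^2 = ec_cubic E x" for x y
    unfolding m_def by (rule ec_points_complete_square)
  have F_in: "case_prod Affine_Point (F (x, y)) \<in> ec_points E" if "Affine_Point x y \<in> ec_points E" for x y
    using that s unfolding F_def by (auto simp: mem)
  have "continuous_map (ec_topology E) (ec_topology E) f"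
    unfolding f_def
  proof (rule continuous_map_ec_topology)
    let ?C = "{(x, y). Affine_Point x y \<in> ec_points E}"
    have "continuous_on ?C (\<lambda>u. (\<lambda>(x, z). s x * z) (fst u, snd u + m (fst u)))"
      unfolding m_def
      by (rule continuous_on_compose2[OF cont_s]) (auto intro!: continuous_intros simp: mem m_def)
    moreover have "continuous_on ?C (\<lambda>u. g (fst u))"
      by (intro continuous_on_compose2[OF g(1)] continuous_intros) auto
    ultimately have "continuous_on ?C
        (\<lambda>u. (g (fst u), (\<lambda>(x, z). s x * z) (fst u, snd u + m (fst u)) - m (g (fst u))))"
      unfolding m_def by (intro continuous_on_Pair continuous_intros) auto
    then show "continuous_on ?C F"
      by (simp add: F_def case_prod_unfold)
  next
    show "case_prod Affine_Point (F (x, y)) \<in> ec_points E" if "Affine_Point x y \<in> ec_points E" for x y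
      using that by (rule F_in)
  next
    fix R
    \<comment> \<open>Properness of \<open>g\<close>: it is bounded on the ball of radius
      \<open>R\<close>, and \<open>x = g (g x)\<close>, so a point \<open>x\<close> outside the
      resulting bound cannot have \<open>g x\<close> in that ball.\<close>
    have "bounded (g ` cball 0 R)"
      by (intro compact_imp_bounded compact_continuous_image continuous_on_subset[OF g(1)]) auto
    then obtain R' where "\<forall>y\<in>g ` cball 0 R. norm y \<le> R'"
      unfolding bounded_iff by (rule exE)
    then have R': "norm (g x) \<le> R'" if "norm x \<le> R" for x
      using that by simp
    have "R < norm (g x)" if "R' < norm x" for x
      using R'[of "g x"] that by (force simp: g(2))
    then show "\<exists>R'. \<forall>x y. Affine_Point x y \<in> ec_points E \<longrightarrow> R' < norm x \<longrightarrow> R < norm (fst (F (x, y)))"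
      unfolding F_def by auto
  qed
  moreover have "inverse_ambiguous (ec_group E) f"
  proof (rule inverse_ambiguous_ec_groupI)
    fix P assume P: "P \<in> ec_points E"
    show "f P \<in> ec_points E"
      using P F_in by (cases P) (auto simp: f_def infinity_mem_ec_points)
    show "f (f P) = ec_neg E P"
    proof (cases P)
      case (Affine_Point x y)
      then have "s (g x) * (s x * (y + m x)) = - (y + m x)"
        using P s by (simp add: mem)
      then show ?thesis
        unfolding Affine_Point f_def F_def ec_neg_def
        by (simp add: g(2)) (simp add: m_def field_simps)
    qed (simp add: f_def ec_neg_def)
  qed
  ultimately show ?thesis by blast
qed

end
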